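(* There exists a prolate ellipsoid $\mathcal{E}\subset\mathbb{R}^3$ with center $O$ such that three is the minimal number of balls needed to generate the shadow at $O$, both for open and for closed balls. That is, for open balls and likewise for closed balls: (i) there exist three pairwise non-overlapping open (respectively, closed) balls with centers on $\mathcal{E}$, none of which contains $O$, which generate the shadow at $O$; and (ii) no collection of fewer than three pairwise non-overlapping open (respectively, closed) balls with centers on $\mathcal{E}$, none of which contains $O$, generates the shadow at $O$.
   Context: A prolate ellipsoid in $\mathbb{R}^3$ is the surface which, in suitable Cartesian coordinates centered at its center $O$ and up to scaling, is given by $\frac{x_1^2}{d^2}+x_2^2+x_3^2=1$ with $d>1$ (an ellipsoid of revolution about its major axis; $d$ is the ratio of the major to the minor axis). Balls are Euclidean balls of positive radius in $\mathbb{R}^3$; the radii may differ. Non-overlapping means pairwise disjoint. A collection of sets generates the shadow at a point $O$ if every (two-sided infinite) straight line passing through $O$ intersects at least one of the sets of the collection. *)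

theory Defs
  imports "HOL-Analysis.Analysis"
begin

text \<open>The map \<open>u \<mapsto> p + s *\<^sub>R f u\<close> passes from the adapted Cartesian
  coordinates \<open>u\<close> centered at \<open>p\<close> to the ambient space, up to the scaling factor \<open>s\<close>.\<close>

definition prolate_ellipsoid :: "(real^3) set \<Rightarrow> real^3 \<Rightarrow> bool" where
  "prolate_ellipsoid E p \<longleftrightarrow>
     (\<exists>(d::real) (s::real) (f :: real^3 \<Rightarrow> real^3).
        d > 1 \<and> s > 0 \<and> orthogonal_transformation f \<and>
        E = {p + s *\<^sub>R f u | u. (u $ 1)\<^sup>2 / d\<^sup>2 + (u $ 2)\<^sup>2 + (u $ 3)\<^sup>2 = 1})"

definition generates_shadow :: "(real^3) set set \<Rightarrow> real^3 \<Rightarrow> bool" where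
  "generates_shadow F p \<longleftrightarrow>
     (\<forall>L. affine L \<and> aff_dim L = 1 \<and> p \<in> L \<longrightarrow> (\<exists>S\<in>F. L \<inter> S \<noteq> {}))"

text \<open>The parameter \<open>B\<close> is \<^const>\<open>ball\<close> or \<^const>\<open>cball\<close>. Collections are sets of balls,
  which loses nothing: pairwise disjoint nonempty members of a family are distinct.\<close>

definition admissible_balls ::
    "(real^3 \<Rightarrow> real \<Rightarrow> (real^3) set) \<Rightarrow> (real^3) set \<Rightarrow> real^3 \<Rightarrow> (real^3) set set \<Rightarrow> bool" where
  "admissible_balls B E p F \<longleftrightarrow>
     (\<forall>S\<in>F. (\<exists>c r. c \<in> E \<and> r > 0 \<and> S = B c r) \<and> p \<notin> S) \<and> disjoint F"

definition minimal_shadow_number ::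
    "(real^3 \<Rightarrow> real \<Rightarrow> (real^3) set) \<Rightarrow> (real^3) set \<Rightarrow> real^3 \<Rightarrow> nat \<Rightarrow> bool" where
  "minimal_shadow_number B E p n \<longleftrightarrow>
     (\<exists>F. finite F \<and> card F = n \<and> admissible_balls B E p F \<and> generates_shadow F p) \<and>
     \<not> (\<exists>F. finite F \<and> card F < n \<and> admissible_balls B E p F \<and> generates_shadow F p)"

end

theory Submission
  imports Defs
begin

text \<open>
  An open ball \<open>ball c r\<close> meets exactly the lines through \<open>0\<close> whose direction \<open>u\<close>
  satisfies \<open>(u \<bullet> c)\<^sup>2 > (norm u)\<^sup>2 * ((norm c)\<^sup>2 - r\<^sup>2)\<close>.

  Two balls never suffice, whatever surface carries their centers. Some direction is orthogonal to
  both centers (as seen from \<open>p\<close>), and on the line through \<open>p\<close> in that direction the point \<open>p\<close>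
  itself is the closest one to either center, so a ball that avoids \<open>p\<close> avoids the whole line
  (lemma \<open>few_balls_no_shadow\<close>).

  Three balls suffice on a sufficiently long ellipsoid. Put the centers on the three axes, at
  distances \<open>a i\<close> from \<open>0\<close>. A missed unit direction \<open>u\<close> has \<open>(u $ i)\<^sup>2 \<le> 1 - (r i / a i)\<^sup>2\<close> for
  every \<open>i\<close>, and adding up these inequalities shows that there is none as soon as
  \<open>(\<Sum>i. (r i / a i)\<^sup>2) > 2\<close> (lemma \<open>axis_balls_generate_shadow\<close>). Disjointness asks for
  \<open>(r i + r j)\<^sup>2 < (a i)\<^sup>2 + (a j)\<^sup>2\<close>. If the two unit semi-axes carry radii close to \<open>1\<close> and to
  \<open>sqrt 2 - 1\<close>, they contribute about \<open>4 - 2 * sqrt 2 \<approx> 1.17\<close> to the sum while their balls remain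
  disjoint. The ball at the end of the major semi-axis \<open>d\<close> may have radius about \<open>d - 1\<close> and
  contributes \<open>(1 - 1 / d)\<^sup>2\<close>, which tends to \<open>1\<close> as \<open>d\<close> grows. So large \<open>d\<close> works; the choice
  here is \<open>d = 20\<close> with radii \<open>19\<close>, \<open>0.99\<close> and \<open>0.42\<close>. Since all inequalities are strict, the
  same centers and radii serve open and closed balls.
\<close>

lemma affine_aff_dim_line:
  fixes p u :: "'a::euclidean_space"
  assumes "u \<noteq> 0"
  shows "affine ((+) p ` span {u}) \<and> aff_dim ((+) p ` span {u}) = 1"
  using assms
  by (simp add: affine_translation[symmetric] subspace_imp_affine aff_dim_translation_eq
      aff_dim_subspace dim_insert)

lemma dist_orthogonal_line:
  fixes c p u :: "'a::real_inner"
  assumes "u \<bullet> (c - p) = 0"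
  shows "dist c p \<le> dist c (p + t *\<^sub>R u)"
proof -
  have "orthogonal (c - p) (- (t *\<^sub>R u))"
    using assms by (simp add: orthogonal_def inner_commute)
  then have "(norm (c - p))\<^sup>2 \<le> (norm ((c - p) + - (t *\<^sub>R u)))\<^sup>2"
    by (simp only: norm_add_Pythagorean) simp
  then show ?thesis
    by (simp add: dist_norm diff_diff_eq)
qed

text \<open>The only property of open and closed balls that matters for the lower bound is that they
  contain, with a point, all points closer to the center.\<close>

lemma few_balls_no_shadow:
  assumes B: "\<And>c r x y. x \<in> B c r \<Longrightarrow> dist c y \<le> dist c x \<Longrightarrow> y \<in> B c r"
    and fin: "finite F" and few: "card F < 3" and adm: "admissible_balls B E p F"
  shows "\<not> generates_shadow F p"
proof
  assume shadow: "generates_shadow F p"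
  from adm obtain c r where cr: "\<And>S. S \<in> F \<Longrightarrow> S = B (c S) (r S)" and p: "\<And>S. S \<in> F \<Longrightarrow> p \<notin> S"
    unfolding admissible_balls_def by metis
  let ?C = "(\<lambda>S. c S - p) ` F"
  have "dim ?C \<le> card ?C"
    using fin by (intro dim_le_card') auto
  also have "\<dots> \<le> card F"
    using fin by (rule card_image_le)
  also have "\<dots> < DIM(real^3)"
    using few by simp
  finally obtain u where "u \<noteq> 0" and u: "\<And>y. y \<in> span ?C \<Longrightarrow> orthogonal u y"
    using orthogonal_to_subspace_exists by blast
  let ?L = "(+) p ` span {u}"
  have "p \<in> ?L"
    using span_zero by (force simp: image_iff)
  with affine_aff_dim_line[OF \<open>u \<noteq> 0\<close>, of p] shadow obtain S x where "S \<in> F" "x \<in> ?L" "x \<in> S"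
    unfolding generates_shadow_def by blast
  then obtain t where "x = p + t *\<^sub>R u"
    by (auto simp: span_singleton)
  moreover have "u \<bullet> (c S - p) = 0"
    using u[OF span_base] \<open>S \<in> F\<close> by (auto simp: orthogonal_def)
  ultimately have "dist (c S) p \<le> dist (c S) x"
    using dist_orthogonal_line by blast
  then show False
    using B cr p \<open>S \<in> F\<close> \<open>x \<in> S\<close> by metis
qed

text \<open>The witness is the point of the line closest to \<open>c\<close>, the foot of the perpendicular.\<close>

lemma line_meets_ball:
  fixes c u :: "'a::real_inner"
  assumes "r > 0" and "(norm u)\<^sup>2 * ((norm c)\<^sup>2 - r\<^sup>2) < (u \<bullet> c)\<^sup>2"
  shows "\<exists>t. t *\<^sub>R u \<in> ball c r"
proof -
  have u: "(norm u)\<^sup>2 > 0"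
    using assms by auto
  define t where "t = (u \<bullet> c) / (norm u)\<^sup>2"
  have "(norm (c - t *\<^sub>R u))\<^sup>2 = (norm c)\<^sup>2 - 2 * t * (u \<bullet> c) + t\<^sup>2 * (norm u)\<^sup>2"
    unfolding power2_norm_eq_inner
    by (simp add: inner_diff inner_commute power2_eq_square algebra_simps)
  also have "\<dots> = (norm c)\<^sup>2 - (u \<bullet> c)\<^sup>2 / (norm u)\<^sup>2"
    using u by (simp add: t_def field_simps power2_eq_square)
  also have "\<dots> < r\<^sup>2"
    using assms(2) u by (simp add: field_simps)
  finally have "norm (c - t *\<^sub>R u) < r"
    using \<open>r > 0\<close> by (simp add: power2_less_imp_less)
  then show ?thesis
    by (auto simp: dist_norm)
qed

lemma axis_balls_generate_shadow:
  fixes a r :: "3 \<Rightarrow> real"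
  assumes a: "\<And>i. a i > 0" and r: "\<And>i. r i > 0" and sum: "(\<Sum>i\<in>UNIV. (r i / a i)\<^sup>2) > 2"
    and B: "\<And>c s. ball c s \<subseteq> B c s"
  shows "generates_shadow (range (\<lambda>i. B (a i *\<^sub>R axis i 1) (r i))) 0"
  unfolding generates_shadow_def
proof (intro allI impI)
  fix L :: "(real^3) set"
  assume L: "affine L \<and> aff_dim L = 1 \<and> 0 \<in> L"
  then have sub: "subspace L"
    using subspace_affine by blast
  have "\<not> L \<subseteq> {0}"
    using L sub aff_dim_subspace[OF sub] dim_eq_0[of L] by auto
  then obtain u where "u \<in> L" "u \<noteq> 0"
    by blast
  have norm_u: "(norm u)\<^sup>2 = (\<Sum>i\<in>UNIV. (u $ i)\<^sup>2)"
    unfolding power2_norm_eq_inner inner_vec_def by (simp add: power2_eq_square)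
  have "\<exists>i. (norm u)\<^sup>2 * (1 - (r i / a i)\<^sup>2) < (u $ i)\<^sup>2"
  proof (rule ccontr)
    assume "\<not> ?thesis"
    then have "(\<Sum>i\<in>UNIV. (u $ i)\<^sup>2) \<le> (\<Sum>i\<in>UNIV. (norm u)\<^sup>2 * (1 - (r i / a i)\<^sup>2))"
      by (intro sum_mono) (auto simp: not_less)
    also have "\<dots> = (norm u)\<^sup>2 * (3 - (\<Sum>i\<in>UNIV. (r i / a i)\<^sup>2))"
      by (simp add: sum_distrib_left[symmetric] sum_subtractf)
    also have "\<dots> < (norm u)\<^sup>2 * 1"
      using sum \<open>u \<noteq> 0\<close> by (intro mult_strict_left_mono) auto
    finally show False
      by (simp add: norm_u)
  qed
  then obtain i where i: "(norm u)\<^sup>2 * (1 - (r i / a i)\<^sup>2) < (u $ i)\<^sup>2" ..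
  have "(norm u)\<^sup>2 * ((a i)\<^sup>2 - (r i)\<^sup>2) = (a i)\<^sup>2 * ((norm u)\<^sup>2 * (1 - (r i / a i)\<^sup>2))"
    using a[of i] by (simp add: field_simps)
  also have "\<dots> < (a i)\<^sup>2 * (u $ i)\<^sup>2"
    using i a[of i] by (intro mult_strict_left_mono) auto
  finally have "(norm u)\<^sup>2 * ((norm (a i *\<^sub>R axis i 1 :: real^3))\<^sup>2 - (r i)\<^sup>2)
      < (u \<bullet> (a i *\<^sub>R axis i 1))\<^sup>2"
    by (simp add: inner_axis power_mult_distrib)
  from line_meets_ball[OF r this] obtain t where "t *\<^sub>R u \<in> ball (a i *\<^sub>R axis i 1) (r i)" ..
  moreover have "t *\<^sub>R u \<in> L"
    using sub \<open>u \<in> L\<close> by (rule subspace_mul)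
  ultimately show "\<exists>S\<in>range (\<lambda>i. B (a i *\<^sub>R axis i 1) (r i)). L \<inter> S \<noteq> {}"
    using B by blast
qed

lemma disjoint_axis_cballs:
  fixes a r :: "'n::finite \<Rightarrow> real"
  assumes "i \<noteq> j" and "(r i + r j)\<^sup>2 < (a i)\<^sup>2 + (a j)\<^sup>2"
  shows "cball (a i *\<^sub>R axis i 1 :: real^'n) (r i) \<inter> cball (a j *\<^sub>R axis j 1) (r j) = {}"
proof -
  have "(dist (a i *\<^sub>R axis i 1) (a j *\<^sub>R axis j 1 :: real^'n))\<^sup>2 = (a i)\<^sup>2 + (a j)\<^sup>2"
    unfolding dist_norm power2_norm_eq_inner using \<open>i \<noteq> j\<close>
    by (simp add: inner_diff inner_axis_axis power2_eq_square)
  with assms(2) have "r i + r j < dist (a i *\<^sub>R axis i 1) (a j *\<^sub>R axis j 1 :: real^'n)"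
    by (metis power2_less_imp_less zero_le_dist)
  then show ?thesis
    by (rule disjoint_cballI)
qed

text \<open>Stating the bounds on \<open>B\<close> as inclusions between \<open>ball\<close> and \<open>cball\<close> treats open and closed
  balls at once: shadows are inherited by larger sets, disjointness by smaller ones.\<close>

lemma minimal_shadow_number_axis_balls:
  fixes a r :: "3 \<Rightarrow> real"
  assumes lower: "\<And>c s. ball c s \<subseteq> B c s" and upper: "\<And>c s. B c s \<subseteq> cball c s"
    and B: "\<And>c s x y. x \<in> B c s \<Longrightarrow> dist c y \<le> dist c x \<Longrightarrow> y \<in> B c s"
    and E: "\<And>i. a i *\<^sub>R axis i 1 \<in> E"
    and r: "\<And>i. 0 < r i" "\<And>i. r i < a i"
    and sum: "(\<Sum>i\<in>UNIV. (r i / a i)\<^sup>2) > 2"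
    and sep: "\<And>i j. i \<noteq> j \<Longrightarrow> (r i + r j)\<^sup>2 < (a i)\<^sup>2 + (a j)\<^sup>2"
  shows "minimal_shadow_number B E 0 3"
proof -
  define b where "b i = B (a i *\<^sub>R axis i 1) (r i)" for i
  have disj: "b i \<inter> b j = {}" if "i \<noteq> j" for i j
    using disjoint_axis_cballs[OF that sep[OF that]] upper unfolding b_def by blast
  have center: "a i *\<^sub>R axis i 1 \<in> b i" for i
    using lower r(1)[of i] unfolding b_def by (meson centre_in_ball subsetD)
  have "inj b"
    using disj center by (metis disjoint_iff injI)
  then have "card (range b) = 3"
    by (simp add: card_image)
  have "0 \<notin> b i" for i
  proof -
    have "0 \<notin> cball (a i *\<^sub>R axis i 1 :: real^3) (r i)"
      using r[of i] by simp
    then show ?thesis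
      using upper unfolding b_def by blast
  qed
  moreover have "\<exists>c s. c \<in> E \<and> 0 < s \<and> b i = B c s" for i
    using E r(1) unfolding b_def by blast
  moreover have "disjoint (range b)"
    unfolding disjoint_def by (metis disj imageE)
  ultimately have "finite (range b) \<and> card (range b) = 3 \<and> admissible_balls B E 0 (range b)"
    using \<open>card (range b) = 3\<close> unfolding admissible_balls_def by auto
  moreover have "generates_shadow (range b) 0"
    unfolding b_def using r sum lower
    by (intro axis_balls_generate_shadow) (auto intro: less_trans)
  moreover have "\<not> generates_shadow F 0"
    if "finite F" "card F < 3" "admissible_balls B E 0 F" for F
    using B that by (rule few_balls_no_shadow)
  ultimately show ?thesis
    unfolding minimal_shadow_number_def by meson
qed

theorem mainTheorem1:
  "\<exists>(E :: (real^3) set) (p :: real^3).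
     prolate_ellipsoid E p \<and>
     minimal_shadow_number ball E p 3 \<and>
     minimal_shadow_number cball E p 3"
proof -
  define E where "E = {u :: real^3. (u $ 1)\<^sup>2 / 20\<^sup>2 + (u $ 2)\<^sup>2 + (u $ 3)\<^sup>2 = 1}"
  define a r :: "3 \<Rightarrow> real" where
    "a i = (vector [20, 1, 1] :: real^3) $ i" and
    "r i = (vector [19, 99/100, 42/100] :: real^3) $ i" for i
  have E: "a i *\<^sub>R axis i 1 \<in> E" for i
  proof -
    have "\<forall>i. a i *\<^sub>R axis i 1 \<in> E"
      by (simp add: forall_3 E_def a_def axis_def)
    then show ?thesis ..
  qed
  have "\<forall>i. 0 < r i \<and> r i < a i"
    by (simp add: forall_3 a_def r_def)
  then have r: "0 < r i" "r i < a i" for i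
    by auto
  have sum: "(\<Sum>i\<in>UNIV. (r i / a i)\<^sup>2) > 2"
    by (simp add: sum_3 a_def r_def power2_eq_square)
  have "\<forall>i j. i \<noteq> j \<longrightarrow> (r i + r j)\<^sup>2 < (a i)\<^sup>2 + (a j)\<^sup>2"
    by (simp add: forall_3 a_def r_def power2_eq_square)
  then have sep: "(r i + r j)\<^sup>2 < (a i)\<^sup>2 + (a j)\<^sup>2" if "i \<noteq> j" for i j
    using that by blast
  have "prolate_ellipsoid E 0"
    unfolding prolate_ellipsoid_def
    by (rule exI[of _ 20], rule exI[of _ 1], rule exI[of _ "\<lambda>x. x"])
      (simp add: E_def)
  moreover have "minimal_shadow_number ball E 0 3"
    by (rule minimal_shadow_number_axis_balls[OF _ _ _ E r sum sep]) auto
  moreover have "minimal_shadow_number cball E 0 3"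
    by (rule minimal_shadow_number_axis_balls[OF _ _ _ E r sum sep]) auto
  ultimately show ?thesis
    by blast
qed

end
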